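(* Let $n\equiv0\pmod4$, $n\ge4$. Then $N$ is a normal subgroup of $\mathrm{Sol}_{A_n^2}$.
   Context: $A_n$ is the $n\times n$ complex matrix with $(A_n)_{i,i+1}=1$ for $1\le i\le n-1$ and zeros elsewhere; $A_n^2$ is its square. $\mathrm{Sol}_{A_n^2}=\{X\in M_n(\mathbb{C}) : X^tA_n^2X=A_n^2\}$, which is a group under matrix multiplication for $n\ge4$. Put $m=n/2$ and view $n\times n$ matrices as $m\times m$ matrices of $2\times2$ blocks $X_{(p,q)}$, $1\le p,q\le m$. $N$ is the set of all $X$ for which there exist $x_1,\dots,x_{(m-2)/2}\in M_2(\mathbb{C})$ such that: $X_{(p,p)}=I_2$ for all $p$; $X_{(p,q)}=x_{(q-p)/2}$ for $p,q$ odd, $p<q$; $X_{(p,q)}=-x_{(p-q)/2}^t+x_{(p-q)/2}^*$ for $p,q$ even, $p>q$; and $X_{(p,q)}=0$ otherwise. Here $x_l^*\in M_2(\mathbb{C})$ is defined recursively by $x_l^*=\sum_{r+s=l,\ r,s\ge1}x_s^t(x_r^t-x_r^* )$ (so $x_1^*=0$), where $^t$ is transpose. *)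

theory Defs
  imports "Jordan_Normal_Form.Matrix" "HOL-Algebra.Coset"
begin

text \<open>Matrices of the library are indexed from 0, so the superdiagonal is still \<open>j = i + 1\<close>.\<close>

definition shift_mat :: "nat \<Rightarrow> complex mat" where
  "shift_mat n = mat n n (\<lambda>(i, j). if j = i + 1 then 1 else 0)"

definition Sol :: "nat \<Rightarrow> complex mat \<Rightarrow> complex mat set" where
  "Sol n B = {X \<in> carrier_mat n n. transpose_mat X * B * X = B}"

definition Sol_monoid :: "nat \<Rightarrow> complex mat \<Rightarrow> complex mat monoid" where
  "Sol_monoid n B = \<lparr>carrier = Sol n B, monoid.mult = (*), one = 1\<^sub>m n\<rparr>"

text \<open>Block positions are counted from 1: the parity of a position matters in \<open>N_set\<close> below.\<close>

definition block2 :: "complex mat \<Rightarrow> nat \<Rightarrow> nat \<Rightarrow> complex mat" where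
  "block2 X p q = mat 2 2 (\<lambda>(i, j). X $$ (2 * (p - 1) + i, 2 * (q - 1) + j))"

text \<open>
  \<open>x\<^sub>l\<^sup>* = \<Sum> x\<^sub>s\<^sup>t (x\<^sub>r\<^sup>t - x\<^sub>r\<^sup>*)\<close> over \<open>r + s = l\<close> with \<open>r, s \<ge> 1\<close>; the sum is taken entrywise
  because the type of matrices of arbitrary dimension has no zero.
\<close>

function star :: "(nat \<Rightarrow> complex mat) \<Rightarrow> nat \<Rightarrow> complex mat" where
  "star x l = mat 2 2 (\<lambda>ij. \<Sum>r\<in>{1..<l}.
     (transpose_mat (x (l - r)) * (transpose_mat (x r) - star x r)) $$ ij)"
  by pat_completeness auto
termination
  by (relation "measure snd") auto

declare star.simps [simp del]

definition N_set :: "nat \<Rightarrow> complex mat set" where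
  "N_set n = (let m = n div 2 in
     {X \<in> carrier_mat n n.
        \<exists>x :: nat \<Rightarrow> complex mat.
          (\<forall>l\<in>{1..(m - 2) div 2}. x l \<in> carrier_mat 2 2) \<and>
          (\<forall>p\<in>{1..m}. \<forall>q\<in>{1..m}.
             block2 X p q =
               (if p = q then 1\<^sub>m 2
                else if odd p \<and> odd q \<and> p < q then x ((q - p) div 2)
                else if even p \<and> even q \<and> p > q
                  then - transpose_mat (x ((p - q) div 2)) + star x ((p - q) div 2)
                else 0\<^sub>m 2 2))})"

end

(*
  B = A^2 is the nilpotent block shift. A solution X is invertible, and with Y its inverse
  transpose, B X = Y B and B^t X = Y B^t. Comparing entries, X splits into a part on the odd block
  positions, upper block Toeplitz with symbol u(z), and a part on the even ones, lower block Toeplitz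
  with symbol v(z), and X is a solution iff u(z)^t v(z) = 1 modulo z^(n/4). The recursion for x^* is
  the recursion for the inverse power series of u(z)^t, so N consists of the solutions with
  u(0) = 1. It is the kernel of the homomorphism X -> u(0), the leading 2 x 2 block.
*)
theory Submission
  imports Defs "Jordan_Normal_Form.Determinant"
begin

section \<open>Sums and indices split by residue modulo 4\<close>

definition kronecker :: "nat \<Rightarrow> nat \<Rightarrow> complex" where
  "kronecker a b = (if a = b then 1 else 0)"

lemma sum_less_2: "(\<Sum>c<2. f c) = f 0 + f (1::nat)"
  for f :: "nat \<Rightarrow> 'a::comm_monoid_add"
  by (simp add: numeral_2_eq_2)

text \<open>With blocks of size 2, the indices \<open>4 * t + c\<close> form the odd block position
  \<open>2 * t + 1\<close> and the indices \<open>4 * t + 2 + c\<close> the even position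
  \<open>2 * t + 2\<close>. The sum is thus taken over pairs of neighbouring blocks.\<close>

lemma sum_lessThan_4_mult:
  "(\<Sum>l<4 * k. f l) = (\<Sum>t<k. \<Sum>c<2. f (4 * t + c) + f (4 * t + 2 + c))"
  for f :: "nat \<Rightarrow> 'a::comm_monoid_add"
proof (induction k)
  case (Suc k)
  have "{..<4 * Suc k} = insert (4*k) (insert (4*k+1) (insert (4*k+2) (insert (4*k+3) {..<4*k})))"
    by auto
  then show ?case
    using Suc by (simp add: sum_less_2 algebra_simps numeral_3_eq_3)
qed simp

lemma nat_4_cases:
  fixes i k :: nat
  assumes "i < 4 * k"
  obtains (0) s a where "s < k" "a < 2" "i = 4 * s + a"
    | (2) s a where "s < k" "a < 2" "i = 4 * s + 2 + a"
proof (cases "i mod 4 < 2")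
  case True
  then show ?thesis using 0[of "i div 4" "i mod 4"] assms by simp
next
  case False
  moreover have "i div 4 < k" "i mod 4 - 2 < 2" using assms by linarith+
  moreover have "i = 4 * (i div 4) + 2 + (i mod 4 - 2)" using False by presburger
  ultimately show ?thesis using 2 by blast
qed

section \<open>The square of the shift matrix\<close>

definition shift2 :: "nat \<Rightarrow> complex mat" where
  "shift2 n = shift_mat n ^\<^sub>m 2"

lemma shift2_carrier [simp]: "shift2 n \<in> carrier_mat n n"
  unfolding shift2_def by (rule pow_carrier_mat) (simp add: shift_mat_def)

lemma shift2_dim [simp]: "dim_row (shift2 n) = n" "dim_col (shift2 n) = n"
  by (rule carrier_matD[OF shift2_carrier])+

lemma shift2_index:
  assumes "i < n" "j < n"
  shows "shift2 n $$ (i, j) = (if j = i + 2 then 1 else 0)"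
proof -
  have "shift2 n $$ (i, j) = (\<Sum>l<n. (if l = i + 1 then 1 else 0) * (if j = l + 1 then 1 else 0))"
    using assms unfolding shift2_def
    by (simp add: numeral_2_eq_2 shift_mat_def scalar_prod_def lessThan_atLeast0)
  also have "\<dots> = (\<Sum>l<n. if l = i + 1 then (if j = i + 2 then 1 else 0) else 0)"
    by (rule sum.cong) auto
  also have "\<dots> = (if j = i + 2 then 1 else 0)"
    using assms by auto
  finally show ?thesis .
qed

lemma shift2_mult_index:
  assumes "X \<in> carrier_mat n n" "i < n" "j < n"
  shows "(shift2 n * X) $$ (i, j) = (if i + 2 < n then X $$ (i + 2, j) else 0)"
proof -
  have "(shift2 n * X) $$ (i, j) = (\<Sum>l<n. shift2 n $$ (i, l) * X $$ (l, j))"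
    using assms by (simp add: scalar_prod_def lessThan_atLeast0)
  also have "\<dots> = (\<Sum>l<n. if l = i + 2 then X $$ (l, j) else 0)"
    using assms by (intro sum.cong) (simp_all add: shift2_index)
  finally show ?thesis by simp
qed

lemma mult_shift2_index:
  assumes "X \<in> carrier_mat n n" "i < n" "j < n"
  shows "(X * shift2 n) $$ (i, j) = (if 2 \<le> j then X $$ (i, j - 2) else 0)"
proof -
  have "(X * shift2 n) $$ (i, j) = (\<Sum>l<n. if j = l + 2 then X $$ (i, l) else 0)"
    using assms
    by (auto simp: scalar_prod_def lessThan_atLeast0 shift2_index intro!: sum.cong)
  also have "\<dots> = (\<Sum>l<n. if l = j - 2 then (if 2 \<le> j then X $$ (i, l) else 0) else 0)"
    by (rule sum.cong) auto
  also have "\<dots> = (if 2 \<le> j then X $$ (i, j - 2) else 0)"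
    using assms by auto
  finally show ?thesis .
qed

lemma transpose_shift2_mult_index:
  assumes "X \<in> carrier_mat n n" "i < n" "j < n"
  shows "(transpose_mat (shift2 n) * X) $$ (i, j) = (if 2 \<le> i then X $$ (i - 2, j) else 0)"
proof -
  have "transpose_mat (shift2 n) * X = transpose_mat (transpose_mat X * shift2 n)"
    using assms by (simp add: transpose_mult[of _ n n _ n])
  then show ?thesis
    using assms mult_shift2_index[of "transpose_mat X" n j i] by auto
qed

lemma mult_transpose_shift2_index:
  assumes "X \<in> carrier_mat n n" "i < n" "j < n"
  shows "(X * transpose_mat (shift2 n)) $$ (i, j) = (if j + 2 < n then X $$ (i, j + 2) else 0)"
proof -
  have "X * transpose_mat (shift2 n) = transpose_mat (shift2 n * transpose_mat X)"
    using assms by (simp add: transpose_mult[of _ n n _ n])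
  then show ?thesis
    using assms shift2_mult_index[of "transpose_mat X" n j i] by auto
qed

section \<open>The solution group\<close>

lemma SolD:
  assumes "X \<in> Sol n B"
  shows "X \<in> carrier_mat n n" "transpose_mat X * B * X = B"
  using assms by (auto simp: Sol_def)

text \<open>Transposing the defining equation. It yields a second equation for the same X, needed
  both for invertibility and for the Toeplitz form.\<close>

lemma Sol_transpose:
  assumes "X \<in> Sol n B" "B \<in> carrier_mat n n"
  shows "X \<in> Sol n (transpose_mat B)"
proof -
  note X = SolD[OF assms(1)]
  have "transpose_mat X * transpose_mat B * X = transpose_mat (transpose_mat X * B * X)"
    using X(1) assms(2)
    by (simp add: transpose_mult[of _ n n _ n] assoc_mult_mat[of _ n n _ n _ n])
  then show ?thesis using X by (simp add: Sol_def)
qed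

lemma Sol_mult:
  assumes "X \<in> Sol n B" "Y \<in> Sol n B" "B \<in> carrier_mat n n"
  shows "X * Y \<in> Sol n B"
proof -
  note X = SolD[OF assms(1)] and Y = SolD[OF assms(2)]
  have "transpose_mat (X * Y) * B * (X * Y) = transpose_mat Y * (transpose_mat X * B * X) * Y"
    using X(1) Y(1) assms(3)
    by (simp add: transpose_mult[of _ n n _ n] assoc_mult_mat[of _ n n _ n _ n])
  then show ?thesis using X Y by (simp add: Sol_def)
qed

text \<open>Multiplying X^t B X = B on the left by Z^t cancels X^t. The quadratic equation becomes
  an intertwining relation that can be compared entry by entry, and multiplying that by Z on the
  right gives closure under inverses.\<close>

lemma Sol_right_inverse:
  assumes "X \<in> Sol n B" "B \<in> carrier_mat n n" "Z \<in> carrier_mat n n" "X * Z = 1\<^sub>m n"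
  shows "B * X = transpose_mat Z * B" "Z \<in> Sol n B"
proof -
  note X = SolD[OF assms(1)]
  have ZX: "transpose_mat Z * transpose_mat X = 1\<^sub>m n"
    using transpose_mult[OF X(1) assms(3)] assms(4) by simp
  have "transpose_mat Z * B = transpose_mat Z * (transpose_mat X * B * X)"
    using X(2) by simp
  also have "\<dots> = (transpose_mat Z * transpose_mat X) * (B * X)"
    using X(1) assms(2,3) by (simp add: assoc_mult_mat[of _ n n _ n _ n])
  also have "\<dots> = B * X"
    using X(1) assms(2) unfolding ZX by simp
  finally show *: "B * X = transpose_mat Z * B" by simp
  have "transpose_mat Z * B * Z = B * (X * Z)"
    using X(1) assms(2,3) unfolding *[symmetric] by (simp add: assoc_mult_mat[of _ n n _ n _ n])
  then show "Z \<in> Sol n B" using assms by (simp add: Sol_def)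
qed

text \<open>
  A kernel vector of \<open>X\<close> is killed by \<open>B\<close> and by its transpose, hence is supported both on the
  first two and on the last two coordinates.
\<close>

lemma Sol_shift2_inverse:
  assumes "X \<in> Sol n (shift2 n)" "n \<ge> 4"
  obtains Z where "Z \<in> carrier_mat n n" "X * Z = 1\<^sub>m n" "Z * X = 1\<^sub>m n"
proof -
  note X = SolD[OF assms(1)] and X' = SolD[OF Sol_transpose[OF assms(1) shift2_carrier]]
  have "det X \<noteq> 0"
  proof
    assume "det X = 0"
    then obtain v where v: "v \<in> carrier_vec n" "v \<noteq> 0\<^sub>v n" "X *\<^sub>v v = 0\<^sub>v n"
      using det_0_iff_vec_prod_zero_field[OF X(1)] by auto
    have kill: "C *\<^sub>v v = 0\<^sub>v n" if "C \<in> carrier_mat n n" "transpose_mat X * C * X = C" for C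
    proof -
      have "C *\<^sub>v v = (transpose_mat X * C) *\<^sub>v (X *\<^sub>v v)"
        using that v X(1) by (metis assoc_mult_mat_vec mult_carrier_mat transpose_carrier_mat)
      also have "\<dots> = 0\<^sub>v n" using that X(1) v by (simp add: mult_mat_vec_def scalar_prod_def) auto
      finally show ?thesis .
    qed
    have comp: "(\<Sum>l<n. C $$ (i, l) * v $ l) = 0"
      if "C \<in> carrier_mat n n" "transpose_mat X * C * X = C" "i < n" for C i
    proof -
      have "(C *\<^sub>v v) $ i = 0" using kill[OF that(1,2)] that(3) by simp
      then show ?thesis using that v by (simp add: scalar_prod_def lessThan_atLeast0)
    qed
    \<comment> \<open>Row \<open>j - 2\<close> of B picks out coordinate \<open>j\<close>. For
      \<open>j < 2\<close> row \<open>j + 2\<close> of the transpose does so, and this row exists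
      because n \<ge> 4.\<close>
    have "v $ j = 0" if j: "j < n" for j
    proof (cases "2 \<le> j")
      case True
      have "(\<Sum>l<n. shift2 n $$ (j - 2, l) * v $ l) = (\<Sum>l<n. if l = j then v $ l else 0)"
        using True j by (intro sum.cong) (auto simp: shift2_index)
      then show ?thesis using comp[OF shift2_carrier X(2), of "j - 2"] j by simp
    next
      case False
      have "(\<Sum>l<n. transpose_mat (shift2 n) $$ (j + 2, l) * v $ l) = (\<Sum>l<n. if l = j then v $ l else 0)"
        using False j assms(2) by (intro sum.cong) (auto simp: shift2_index)
      then show ?thesis using comp[OF _ X'(2), of "j + 2"] j False assms(2) by simp
    qed
    then have "v = 0\<^sub>v n" using v by auto
    with v show False by simp
  qed
  then have "X \<in> Units (ring_mat TYPE(complex) n ())" by (rule det_non_zero_imp_unit[OF X(1)])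
  then show thesis using that by (auto simp: Units_def ring_mat_def)
qed

lemma Sol_group:
  assumes "n \<ge> 4"
  shows "group (Sol_monoid n (shift2 n))"
proof (rule groupI)
  fix X assume "X \<in> carrier (Sol_monoid n (shift2 n))"
  then have X: "X \<in> Sol n (shift2 n)" by (simp add: Sol_monoid_def)
  from Sol_shift2_inverse[OF X assms] obtain Z
    where Z: "Z \<in> carrier_mat n n" "X * Z = 1\<^sub>m n" "Z * X = 1\<^sub>m n" .
  show "\<exists>Z\<in>carrier (Sol_monoid n (shift2 n)). Z \<otimes>\<^bsub>Sol_monoid n (shift2 n)\<^esub> X = \<one>\<^bsub>Sol_monoid n (shift2 n)\<^esub>"
    using Sol_right_inverse(2)[OF X _ Z(1,2)] Z(3) by (auto simp: Sol_monoid_def)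
qed (auto simp: Sol_monoid_def Sol_mult dest: SolD intro: assoc_mult_mat, simp add: Sol_def)

section \<open>Block Toeplitz form\<close>

text \<open>
  \<open>u l\<close> and \<open>v l\<close> are the \<open>2 \<times> 2\<close> blocks on the \<open>2l\<close>-th block superdiagonal in the odd block
  positions, and on the \<open>2l\<close>-th block subdiagonal in the even ones.
\<close>

definition toeplitz ::
  "nat \<Rightarrow> (nat \<Rightarrow> nat \<Rightarrow> nat \<Rightarrow> complex) \<Rightarrow> (nat \<Rightarrow> nat \<Rightarrow> nat \<Rightarrow> complex) \<Rightarrow> complex mat \<Rightarrow> bool" where
  "toeplitz k u v X \<longleftrightarrow> X \<in> carrier_mat (4 * k) (4 * k) \<and> (\<forall>s<k. \<forall>t<k. \<forall>a<2. \<forall>b<2.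
     X $$ (4 * s + a, 4 * t + b) = (if s \<le> t then u (t - s) a b else 0) \<and>
     X $$ (4 * s + 2 + a, 4 * t + 2 + b) = (if t \<le> s then v (s - t) a b else 0) \<and>
     X $$ (4 * s + a, 4 * t + 2 + b) = 0 \<and>
     X $$ (4 * s + 2 + a, 4 * t + b) = 0)"

lemma toeplitzD:
  assumes "toeplitz k u v X"
  shows "X \<in> carrier_mat (4 * k) (4 * k)"
    and "s < k \<Longrightarrow> t < k \<Longrightarrow> a < 2 \<Longrightarrow> b < 2 \<Longrightarrow>
      X $$ (4 * s + a, 4 * t + b) = (if s \<le> t then u (t - s) a b else 0)"
    and "s < k \<Longrightarrow> t < k \<Longrightarrow> a < 2 \<Longrightarrow> b < 2 \<Longrightarrow>
      X $$ (4 * s + 2 + a, 4 * t + 2 + b) = (if t \<le> s then v (s - t) a b else 0)"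
    and "s < k \<Longrightarrow> t < k \<Longrightarrow> a < 2 \<Longrightarrow> b < 2 \<Longrightarrow> X $$ (4 * s + a, 4 * t + 2 + b) = 0"
    and "s < k \<Longrightarrow> t < k \<Longrightarrow> a < 2 \<Longrightarrow> b < 2 \<Longrightarrow> X $$ (4 * s + 2 + a, 4 * t + b) = 0"
  using assms unfolding toeplitz_def by blast+

text \<open>
  With \<open>Y\<close> the inverse transpose of \<open>X\<close>, the equations \<open>B X = Y B\<close> and \<open>B\<^sup>t X = Y B\<^sup>t\<close> express the
  entries of \<open>Y\<close> as entries of \<open>X\<close> displaced by \<open>(2, 2)\<close> and by \<open>(-2, -2)\<close>, so \<open>X\<close> is invariant under
  displacement by \<open>(4, 4)\<close>; at the border they give zeros.
\<close>

lemma Sol_toeplitz: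
  assumes X: "X \<in> Sol (4 * k) (shift2 (4 * k))" and k: "k \<ge> 1"
  shows "toeplitz k (\<lambda>l a b. X $$ (a, 4 * l + b)) (\<lambda>l a b. X $$ (4 * l + 2 + a, 2 + b)) X"
proof -
  define n where "n = 4 * k"
  have n: "n \<ge> 4" using k by (simp add: n_def)
  have X': "X \<in> Sol n (shift2 n)" using X by (simp add: n_def)
  note XC = SolD(1)[OF X']
  obtain Z where Z: "Z \<in> carrier_mat n n" "X * Z = 1\<^sub>m n"
    using Sol_shift2_inverse[OF X' n] by blast
  define Y where "Y = transpose_mat Z"
  have Y: "Y \<in> carrier_mat n n" using Z by (simp add: Y_def)
  have R1: "(if i + 2 < n then X $$ (i + 2, j) else 0) = (if 2 \<le> j then Y $$ (i, j - 2) else 0)"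
    if "i < n" "j < n" for i j
    using Sol_right_inverse(1)[OF X' _ Z] shift2_mult_index[OF XC that] mult_shift2_index[OF Y that]
    by (simp add: Y_def)
  have R2: "(if 2 \<le> i then X $$ (i - 2, j) else 0) = (if j + 2 < n then Y $$ (i, j + 2) else 0)"
    if "i < n" "j < n" for i j
    using Sol_right_inverse(1)[OF Sol_transpose[OF X' shift2_carrier] _ Z]
      transpose_shift2_mult_index[OF XC that] mult_transpose_shift2_index[OF Y that]
    by (simp add: Y_def)
  \<comment> \<open>Both sides equal \<open>Y $$ (i + 2, j + 2)\<close>, by \<open>R1\<close> and
    \<open>R2\<close> respectively.\<close>
  have shift1: "X $$ (i + 4, j + 4) = X $$ (i, j)" if "i + 4 < n" "j + 4 < n" for i j
    using R1[of "i + 2" "j + 4"] R2[of "i + 2" j] that by (simp add: numeral_eq_Suc)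
  have shift: "X $$ (i + 4 * t, j + 4 * t) = X $$ (i, j)" if "i + 4 * t < n" "j + 4 * t < n" for i j t
    using that
  proof (induction t)
    case (Suc t)
    then show ?case using shift1[of "i + 4 * t" "j + 4 * t"] by (simp add: algebra_simps)
  qed simp
  \<comment> \<open>Four borders of zeros: the first two columns from row 2 on, the last two columns
    above the last two rows, rows 2 and 3 from column 4 on, and rows n-4 and n-3 before column n-4.
    The first two come from one relation whose other side vanishes at the border; the last two
    compare both relations at a common entry of Y.\<close>
  have zl: "X $$ (i, j) = 0" if "j < 2" "2 \<le> i" "i < n" for i j
    using R1[of "i - 2" j] that le_add_diff_inverse2[of 2 i] by (auto split: if_splits)
  have zr: "X $$ (i, j) = 0" if "i + 2 < n" "n \<le> j + 2" "j < n" for i j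
    using R2[of "i + 2" j] that by auto
  have zt: "X $$ (i, j) = 0" if ij: "2 \<le> i" "i < 4" "4 \<le> j" "j < n" for i j
  proof -
    obtain i' j' where "i = 2 + i'" "j = 4 + j'"
      using le_Suc_ex[OF ij(1)] le_Suc_ex[OF ij(3)] by blast
    then show ?thesis using R1[of i' j] R2[of i' j'] ij by (simp add: numeral_eq_Suc)
  qed
  have zb: "X $$ (i, j) = 0" if "n \<le> i + 4" "i + 2 < n" "j + 4 < n" for i j
    using R2[of "i + 2" j] R1[of "i + 2" "j + 4"] that
    by (auto simp: numeral_eq_Suc split: if_splits)
  have sh: "X $$ (i, j) = X $$ (i', j')"
    if "i = i' + 4 * t" "j = j' + 4 * t" "i < n" "j < n" for i j i' j' t
    using shift[of i' t j'] that by simp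
  show ?thesis unfolding toeplitz_def
  proof (intro conjI allI impI)
    show "X \<in> carrier_mat (4 * k) (4 * k)" using XC by (simp add: n_def)
  next
    fix s t a b :: nat
    assume st: "s < k" "t < k" and ab: "a < 2" "b < 2"
    then have bnd: "4 * s + 4 \<le> n" "4 * t + 4 \<le> n" by (auto simp: n_def)
    show "X $$ (4 * s + a, 4 * t + b) = (if s \<le> t then X $$ (a, 4 * (t - s) + b) else 0)"
    proof (cases "s \<le> t")
      case True
      then have "X $$ (4 * s + a, 4 * t + b) = X $$ (a, 4 * (t - s) + b)"
        using bnd ab by (intro sh[of _ _ s]) auto
      then show ?thesis using True by simp
    next
      case False
      then have "X $$ (4 * s + a, 4 * t + b) = X $$ (4 * (s - t) + a, b)"
        using bnd ab by (intro sh[of _ _ t]) auto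
      also have "\<dots> = 0" using False bnd ab by (intro zl) auto
      finally show ?thesis using False by simp
    qed
    show "X $$ (4 * s + 2 + a, 4 * t + 2 + b) = (if t \<le> s then X $$ (4 * (s - t) + 2 + a, 2 + b) else 0)"
    proof (cases "t \<le> s")
      case True
      then have "X $$ (4 * s + 2 + a, 4 * t + 2 + b) = X $$ (4 * (s - t) + 2 + a, 2 + b)"
        using bnd ab by (intro sh[of _ _ t]) auto
      then show ?thesis using True by simp
    next
      case False
      then have "X $$ (4 * s + 2 + a, 4 * t + 2 + b) = X $$ (2 + a, 4 * (t - s) + 2 + b)"
        using bnd ab by (intro sh[of _ _ s]) auto
      also have "\<dots> = 0" using False bnd ab by (intro zt) auto
      finally show ?thesis using False by simp
    qed
    \<comment> \<open>Here the entry is displaced to the lower right as far as the matrix allows: by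
      \<open>k - 1 - t\<close> steps into the last two columns, or by \<open>k - 1 - s\<close> steps
      into rows n-4 and n-3. The other blocks are displaced to the upper left.\<close>
    show "X $$ (4 * s + a, 4 * t + 2 + b) = 0"
    proof (cases "s \<le> t")
      case True
      then have "X $$ (4 * s + a, 4 * t + 2 + b)
          = X $$ (4 * (s + (k - 1 - t)) + a, 4 * (k - 1) + 2 + b)"
        using st ab by (intro sh[of _ _ "k - 1 - t", symmetric]) (auto simp: n_def)
      also have "\<dots> = 0" using True st ab by (intro zr) (auto simp: n_def)
      finally show ?thesis .
    next
      case False
      then have "X $$ (4 * s + a, 4 * t + 2 + b)
          = X $$ (4 * (k - 1) + a, 4 * (t + (k - 1 - s)) + 2 + b)"
        using st ab by (intro sh[of _ _ "k - 1 - s", symmetric]) (auto simp: n_def)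
      also have "\<dots> = 0" using False st ab by (intro zb) (auto simp: n_def)
      finally show ?thesis .
    qed
    show "X $$ (4 * s + 2 + a, 4 * t + b) = 0"
    proof (cases "t \<le> s")
      case True
      then have "X $$ (4 * s + 2 + a, 4 * t + b) = X $$ (4 * (s - t) + 2 + a, b)"
        using bnd ab by (intro sh[of _ _ t]) auto
      also have "\<dots> = 0" using True bnd ab by (intro zl) auto
      finally show ?thesis .
    next
      case False
      then have "X $$ (4 * s + 2 + a, 4 * t + b) = X $$ (2 + a, 4 * (t - s) + b)"
        using bnd ab by (intro sh[of _ _ s]) auto
      also have "\<dots> = 0" using False bnd ab by (intro zt) auto
      finally show ?thesis .
    qed
  qed
qed

section \<open>The equation X^t B X = B in terms of the symbols\<close>

text \<open>The coefficients of the product of the matrix power series \<open>u\<^sup>t\<close> and \<open>v\<close>.\<close>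

definition conv ::
  "(nat \<Rightarrow> nat \<Rightarrow> nat \<Rightarrow> complex) \<Rightarrow> (nat \<Rightarrow> nat \<Rightarrow> nat \<Rightarrow> complex) \<Rightarrow> nat \<Rightarrow> nat \<Rightarrow> nat \<Rightarrow> complex" where
  "conv u v l a b = (\<Sum>r\<le>l. \<Sum>c<2. u (l - r) c a * v r c b)"

text \<open>Replacing r by r + t turns the overlap of an upper and a lower Toeplitz band into a
  Cauchy product that depends on s - t only.\<close>

lemma sum_window:
  fixes g :: "nat \<Rightarrow> nat \<Rightarrow> 'a::comm_monoid_add"
  assumes "s < k"
  shows "(\<Sum>r<k. if r \<le> s \<and> t \<le> r then g (s - r) (r - t) else 0)
    = (if t \<le> s then \<Sum>r\<le>s - t. g (s - t - r) r else 0)"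
proof (cases "t \<le> s")
  case True
  have "(\<Sum>r<k. if r \<le> s \<and> t \<le> r then g (s - r) (r - t) else 0)
      = (\<Sum>r\<in>{t..s}. g (s - r) (r - t))"
    using assms by (intro sum.mono_neutral_cong_right) auto
  also have "\<dots> = (\<Sum>r\<le>s - t. g (s - t - r) r)"
    by (rule sum.reindex_bij_witness[of _ "\<lambda>r. r + t" "\<lambda>r. r - t"]) (use True in auto)
  finally show ?thesis using True by simp
next
  case False
  then have "(\<Sum>r<k. if r \<le> s \<and> t \<le> r then g (s - r) (r - t) else 0) = 0"
    by (intro sum.neutral) auto
  then show ?thesis using False by simp
qed

text \<open>B raises the row index by 2, so it pairs each odd block row with the even one after it,
  and each even one with the next odd one. The last even block row has no partner, whence the guard
  \<open>r + 1 < k\<close>.\<close>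

lemma Sol_form_index:
  assumes X: "X \<in> carrier_mat (4 * k) (4 * k)" and ij: "i < 4 * k" "j < 4 * k"
  shows "(transpose_mat X * shift2 (4 * k) * X) $$ (i, j) =
    (\<Sum>r<k. \<Sum>c<2. X $$ (4 * r + c, i) * X $$ (4 * r + 2 + c, j)
      + X $$ (4 * r + 2 + c, i) * (if r + 1 < k then X $$ (4 * (r + 1) + c, j) else 0))"
proof -
  let ?f = "\<lambda>l. X $$ (l, i) * (if l + 2 < 4 * k then X $$ (l + 2, j) else 0)"
  have "(transpose_mat X * shift2 (4 * k) * X) $$ (i, j)
      = (transpose_mat X * (shift2 (4 * k) * X)) $$ (i, j)"
    using X by (simp add: assoc_mult_mat[of _ "4 * k" "4 * k" _ "4 * k" _ "4 * k"])
  also have "\<dots> = (\<Sum>l<4 * k. X $$ (l, i) * (shift2 (4 * k) * X) $$ (l, j))"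
    using X ij by (subst index_mult_mat(1)) (auto simp: scalar_prod_def lessThan_atLeast0 intro!: sum.cong)
  also have "\<dots> = (\<Sum>l<4 * k. ?f l)"
    using X ij by (intro sum.cong) (simp_all add: shift2_mult_index del: index_mult_mat(1))
  also have "\<dots> = (\<Sum>r<k. \<Sum>c<2. ?f (4 * r + c) + ?f (4 * r + 2 + c))"
    by (rule sum_lessThan_4_mult)
  also have "\<dots> = (\<Sum>r<k. \<Sum>c<2. X $$ (4 * r + c, i) * X $$ (4 * r + 2 + c, j)
      + X $$ (4 * r + 2 + c, i) * (if r + 1 < k then X $$ (4 * (r + 1) + c, j) else 0))"
  proof (intro sum.cong refl)
    fix r c :: nat assume "r \<in> {..<k}" "c \<in> {..<2}"
    then have "4 * r + 2 + c < 4 * k" "4 * (r + 1) + c < 4 * k \<longleftrightarrow> r + 1 < k" by auto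
    moreover have "4 * r + c + 2 = 4 * r + 2 + c" "4 * r + 2 + c + 2 = 4 * (r + 1) + c" by auto
    ultimately show "?f (4 * r + c) + ?f (4 * r + 2 + c) = X $$ (4 * r + c, i) * X $$ (4 * r + 2 + c, j)
      + X $$ (4 * r + 2 + c, i) * (if r + 1 < k then X $$ (4 * (r + 1) + c, j) else 0)"
      by presburger
  qed
  finally show ?thesis .
qed

text \<open>X preserves the splitting into odd and even positions while B exchanges the two parts,
  so only the mixed blocks survive. One of them holds the coefficients of u(z)^t v(z). The other
  holds their transposes, moved by one step because B leads from an even position to the next odd
  one.\<close>

lemma toeplitz_form_index:
  assumes X: "toeplitz k u v X" and st: "s < k" "t < k" and ab: "a < 2" "b < 2"
  defines "M \<equiv> transpose_mat X * shift2 (4 * k) * X"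
  shows "M $$ (4 * s + a, 4 * t + b) = 0"
    and "M $$ (4 * s + 2 + a, 4 * t + 2 + b) = 0"
    and "M $$ (4 * s + a, 4 * t + 2 + b) = (if t \<le> s then conv u v (s - t) a b else 0)"
    and "M $$ (4 * s + 2 + a, 4 * t + b) = (if s < t then conv u v (t - Suc s) b a else 0)"
proof -
  note D = toeplitzD[OF X]
  note I = Sol_form_index[OF D(1), folded M_def]
  have sum_if: "(\<Sum>c<2::nat. if P then f c else 0) = (if P then \<Sum>c<2. f c else 0)"
    for P and f :: "nat \<Rightarrow> complex"
    by simp
  have bnd: "4 * s + 2 + a < 4 * k" "4 * t + 2 + b < 4 * k" "4 * s + a < 4 * k" "4 * t + b < 4 * k"
    using st ab by auto
  show "M $$ (4 * s + a, 4 * t + b) = 0"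
    unfolding I[OF bnd(3,4)]
  proof (intro sum.neutral ballI)
    fix r c :: nat assume "r \<in> {..<k}" "c \<in> {..<2}"
    then have rc: "r < k" "c < 2" by auto
    show "X $$ (4 * r + c, 4 * s + a) * X $$ (4 * r + 2 + c, 4 * t + b) + X $$ (4 * r + 2 + c, 4 * s + a) *
      (if r + 1 < k then X $$ (4 * (r + 1) + c, 4 * t + b) else 0) = 0"
      unfolding D(5)[OF rc(1) st(1) rc(2) ab(1)] D(5)[OF rc(1) st(2) rc(2) ab(2)] by simp
  qed
  show "M $$ (4 * s + 2 + a, 4 * t + 2 + b) = 0"
    unfolding I[OF bnd(1,2)]
  proof (intro sum.neutral ballI)
    fix r c :: nat assume "r \<in> {..<k}" "c \<in> {..<2}"
    then have rc: "r < k" "c < 2" by auto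
    have "(if r + 1 < k then X $$ (4 * (r + 1) + c, 4 * t + 2 + b) else 0) = 0"
      using D(4)[OF _ st(2) rc(2) ab(2)] by presburger
    then show "X $$ (4 * r + c, 4 * s + 2 + a) * X $$ (4 * r + 2 + c, 4 * t + 2 + b) + X $$ (4 * r + 2 + c, 4 * s + 2 + a) *
      (if r + 1 < k then X $$ (4 * (r + 1) + c, 4 * t + 2 + b) else 0) = 0"
      unfolding D(4)[OF rc(1) st(1) rc(2) ab(1)] by simp
  qed
  have "M $$ (4 * s + a, 4 * t + 2 + b)
      = (\<Sum>r<k. \<Sum>c<2. if r \<le> s \<and> t \<le> r then u (s - r) c a * v (r - t) c b else 0)"
    unfolding I[OF bnd(3,2)]
  proof (intro sum.cong refl)
    fix r c :: nat assume "r \<in> {..<k}" "c \<in> {..<2}"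
    then have rc: "r < k" "c < 2" by auto
    show "X $$ (4 * r + c, 4 * s + a) * X $$ (4 * r + 2 + c, 4 * t + 2 + b) + X $$ (4 * r + 2 + c, 4 * s + a) *
      (if r + 1 < k then X $$ (4 * (r + 1) + c, 4 * t + 2 + b) else 0)
      = (if r \<le> s \<and> t \<le> r then u (s - r) c a * v (r - t) c b else 0)"
      unfolding D(2)[OF rc(1) st(1) rc(2) ab(1)] D(3)[OF rc(1) st(2) rc(2) ab(2)]
        D(5)[OF rc(1) st(1) rc(2) ab(1)] by simp
  qed
  also have "\<dots> = (\<Sum>r<k. if r \<le> s \<and> t \<le> r then \<Sum>c<2. u (s - r) c a * v (r - t) c b else 0)"
    by (simp only: sum_if)
  also have "\<dots> = (if t \<le> s then conv u v (s - t) a b else 0)"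
    unfolding conv_def by (rule sum_window[OF st(1), where g = "\<lambda>i j. \<Sum>c<2. u i c a * v j c b"])
  finally show "M $$ (4 * s + a, 4 * t + 2 + b) = (if t \<le> s then conv u v (s - t) a b else 0)" .
  have "M $$ (4 * s + 2 + a, 4 * t + b)
      = (\<Sum>r<k. \<Sum>c<2. if r + 1 \<le> t \<and> s \<le> r then u (t - (r + 1)) c b * v (r - s) c a else 0)"
    unfolding I[OF bnd(1,4)]
  proof (intro sum.cong refl)
    fix r c :: nat assume "r \<in> {..<k}" "c \<in> {..<2}"
    then have rc: "r < k" "c < 2" by auto
    \<comment> \<open>For r = k - 1 the default 0 agrees with the Toeplitz pattern, since t < k
      rules out \<open>r + 1 \<le> t\<close>.\<close>
    have "(if r + 1 < k then X $$ (4 * (r + 1) + c, 4 * t + b) else 0)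
        = (if r + 1 \<le> t then u (t - (r + 1)) c b else 0)"
      using D(2)[OF _ st(2) rc(2) ab(2), of "r + 1"] st(2) by simp
    then show "X $$ (4 * r + c, 4 * s + 2 + a) * X $$ (4 * r + 2 + c, 4 * t + b) + X $$ (4 * r + 2 + c, 4 * s + 2 + a) *
      (if r + 1 < k then X $$ (4 * (r + 1) + c, 4 * t + b) else 0)
      = (if r + 1 \<le> t \<and> s \<le> r then u (t - (r + 1)) c b * v (r - s) c a else 0)"
      unfolding D(3)[OF rc(1) st(1) rc(2) ab(1)] D(4)[OF rc(1) st(1) rc(2) ab(1)] by simp
  qed
  also have "\<dots> = (\<Sum>r<k. if r + 1 \<le> t \<and> s \<le> r then \<Sum>c<2. u (t - (r + 1)) c b * v (r - s) c a else 0)"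
    by (simp only: sum_if)
  also have "\<dots> = (if s < t then conv u v (t - Suc s) b a else 0)"
  proof (cases t)
    case (Suc t')
    then have "t' < k" using st by simp
    from sum_window[OF this, where g = "\<lambda>i j. \<Sum>c<2. u i c b * v j c a" and t = s]
    show ?thesis
      unfolding conv_def Suc
      by (simp only: Suc_eq_plus1[symmetric] diff_Suc_Suc Suc_le_mono less_Suc_eq_le)
  qed simp
  finally show "M $$ (4 * s + 2 + a, 4 * t + b) = (if s < t then conv u v (t - Suc s) b a else 0)" .
qed

text \<open>B has identity blocks exactly at the mixed positions where the coefficient index is 0.
  Both kinds of mixed block therefore impose the same condition, u(z)^t v(z) = 1 modulo z^k.\<close>

lemma toeplitz_Sol_iff:
  assumes X: "toeplitz k u v X"
  shows "X \<in> Sol (4 * k) (shift2 (4 * k)) \<longleftrightarrow>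
    (\<forall>l<k. \<forall>a<2. \<forall>b<2. conv u v l a b = (if l = 0 then kronecker a b else 0))"
    (is "?L \<longleftrightarrow> ?R")
proof
  let ?M = "transpose_mat X * shift2 (4 * k) * X"
  note D = toeplitzD[OF X] and F = toeplitz_form_index[OF X]
  show ?R if ?L
  proof (intro allI impI)
    fix l a b :: nat assume l: "l < k" and ab: "a < 2" "b < 2"
    \<comment> \<open>The first even block column already shows every coefficient below
      \<open>k\<close>.\<close>
    have "conv u v l a b = ?M $$ (4 * l + a, 4 * 0 + 2 + b)"
      using F(3)[of l 0 a b] l ab by simp
    also have "\<dots> = shift2 (4 * k) $$ (4 * l + a, 4 * 0 + 2 + b)"
      using SolD(2)[OF \<open>?L\<close>] by simp
    also have "\<dots> = (if l = 0 then kronecker a b else 0)"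
      using l ab by (subst shift2_index) (auto simp: kronecker_def)
    finally show "conv u v l a b = (if l = 0 then kronecker a b else 0)" .
  qed
  show ?L if ?R
  proof -
    have "?M $$ (i, j) = shift2 (4 * k) $$ (i, j)" if "i < 4 * k" "j < 4 * k" for i j
      using that(1)
    proof (cases rule: nat_4_cases)
      case (0 s a)
      note sa = 0
      from that(2) show ?thesis
      proof (cases rule: nat_4_cases)
        case (0 t b)
        then have "j \<noteq> i + 2" using sa by presburger
        then show ?thesis using 0 sa F(1)[of s t a b] that by (simp only: shift2_index) auto
      next
        case (2 t b)
        then show ?thesis using sa F(3)[of s t a b] that \<open>?R\<close>
          by (simp only: shift2_index) (auto simp: kronecker_def)
      qed
    next
      case (2 s a)
      note sa = 2
      from that(2) show ?thesis
      proof (cases rule: nat_4_cases)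
        case (0 t b)
        then show ?thesis using sa F(4)[of s t a b] that \<open>?R\<close>
          by (simp only: shift2_index) (auto simp: kronecker_def)
      next
        case (2 t b)
        then have "j \<noteq> i + 2" using sa by presburger
        then show ?thesis using 2 sa F(2)[of s t a b] that by (simp only: shift2_index) auto
      qed
    qed
    then have "?M = shift2 (4 * k)" using D(1) by (intro eq_matI) auto
    then show ?L using D(1) by (simp add: Sol_def)
  qed
qed

section \<open>Cancellation of a matrix power series with constant term 1\<close>

lemma conv_unit:
  assumes "\<And>a b. a < 2 \<Longrightarrow> b < 2 \<Longrightarrow> u 0 a b = kronecker a b" "a < 2" "b < 2"
  shows "conv u v l a b = v l a b + (\<Sum>r<l. \<Sum>c<2. u (l - r) c a * v r c b)"
proof -
  have "(\<Sum>c<2. u 0 c a * v l c b) = v l a b"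
    using assms by (auto simp: sum_less_2 kronecker_def less_2_cases_iff)
  then show ?thesis unfolding conv_def by (simp add: lessThan_Suc_atMost[symmetric] add.commute)
qed

text \<open>A series with constant term 1 can be cancelled modulo z^k: by \<open>conv_unit\<close>
  the coefficient \<open>v l\<close> is determined by the product and the earlier coefficients of
  v.\<close>

lemma conv_left_cancel:
  assumes u: "\<And>a b. a < 2 \<Longrightarrow> b < 2 \<Longrightarrow> u 0 a b = kronecker a b"
    and eq: "\<And>l a b. l < k \<Longrightarrow> a < 2 \<Longrightarrow> b < 2 \<Longrightarrow> conv u v l a b = conv u w l a b"
    and "l < k" "a < 2" "b < 2"
  shows "v l a b = w l a b"
  using assms(3-)
proof (induction l arbitrary: a b rule: less_induct)
  case (less l)
  have "(\<Sum>r<l. \<Sum>c<2. u (l - r) c a * v r c b) = (\<Sum>r<l. \<Sum>c<2. u (l - r) c a * w r c b)"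
    using less by (intro sum.cong refl) auto
  then show ?case
    using eq[OF less.prems] less.prems
    by (simp add: conv_unit[of u, OF u])
qed

section \<open>The kernel of the leading block\<close>

definition x_coeff :: "(nat \<Rightarrow> complex mat) \<Rightarrow> nat \<Rightarrow> nat \<Rightarrow> nat \<Rightarrow> complex" where
  "x_coeff x l a b = (if l = 0 then kronecker a b else x l $$ (a, b))"

definition y_coeff :: "(nat \<Rightarrow> complex mat) \<Rightarrow> nat \<Rightarrow> nat \<Rightarrow> nat \<Rightarrow> complex" where
  "y_coeff x l a b = (if l = 0 then kronecker a b else - x l $$ (b, a) + star x l $$ (a, b))"

lemma star_carrier [simp]: "star x l \<in> carrier_mat 2 2"
  by (subst star.simps) simp

lemma star_dim [simp]: "dim_row (star x l) = 2" "dim_col (star x l) = 2"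
  by (rule carrier_matD[OF star_carrier])+

text \<open>In the recursion x_r^t - x_r^* is minus the r-th coefficient of v, so x_l^* is minus the
  part of the l-th coefficient of u^t v that omits the two end terms.\<close>

lemma star_index:
  assumes x: "\<And>r. r \<in> {1..<k} \<Longrightarrow> x r \<in> carrier_mat 2 2" and l: "l < k" and ab: "a < 2" "b < 2"
  shows "star x l $$ (a, b) = - (\<Sum>r\<in>{1..<l}. \<Sum>c<2. x_coeff x (l - r) c a * y_coeff x r c b)"
proof -
  have "(transpose_mat (x (l - r)) * (transpose_mat (x r) - star x r)) $$ (a, b)
      = - (\<Sum>c<2. x_coeff x (l - r) c a * y_coeff x r c b)" if r: "r \<in> {1..<l}" for r
  proof -
    have c: "x (l - r) \<in> carrier_mat 2 2" "x r \<in> carrier_mat 2 2"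
      using l r by (auto intro!: x)
    have "(transpose_mat (x (l - r)) * (transpose_mat (x r) - star x r)) $$ (a, b)
      = (\<Sum>c<2. x (l - r) $$ (c, a) * (x r $$ (b, c) - star x r $$ (c, b)))"
      using c ab by (subst index_mult_mat(1)) (auto simp: scalar_prod_def lessThan_atLeast0 intro!: sum.cong)
    also have "\<dots> = - (\<Sum>c<2. x_coeff x (l - r) c a * y_coeff x r c b)"
      using r unfolding sum_negf[symmetric]
      by (intro sum.cong refl) (auto simp: x_coeff_def y_coeff_def algebra_simps)
    finally show ?thesis .
  qed
  then show ?thesis
    using ab by (subst star.simps) (simp add: sum_negf)
qed

text \<open>For l > 0 the end terms contribute x_l^t and - x_l^t + x_l^*. Their sum x_l^* cancels
  the inner terms by \<open>star_index\<close>.\<close>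

lemma conv_x_y_coeff:
  assumes x: "\<And>r. r \<in> {1..<k} \<Longrightarrow> x r \<in> carrier_mat 2 2" and l: "l < k" and ab: "a < 2" "b < 2"
  shows "conv (x_coeff x) (y_coeff x) l a b = (if l = 0 then kronecker a b else 0)"
proof -
  have *: "conv (x_coeff x) (y_coeff x) l a b = y_coeff x l a b
      + (\<Sum>r<l. \<Sum>c<2. x_coeff x (l - r) c a * y_coeff x r c b)"
    by (rule conv_unit) (auto simp: x_coeff_def ab)
  show ?thesis
  proof (cases "l = 0")
    case True
    then show ?thesis using * by (simp add: y_coeff_def)
  next
    case False
    then have "{..<l} = insert 0 {1..<l}" by auto
    then have "(\<Sum>r<l. \<Sum>c<2. x_coeff x (l - r) c a * y_coeff x r c b)
        = (\<Sum>c<2. x_coeff x l c a * y_coeff x 0 c b) - star x l $$ (a, b)"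
      using star_index[of k x, OF x l ab] by simp
    also have "(\<Sum>c<2. x_coeff x l c a * y_coeff x 0 c b) = x l $$ (b, a)"
      using False ab by (auto simp: x_coeff_def y_coeff_def sum_less_2 kronecker_def less_2_cases_iff)
    finally show ?thesis using * False by (simp add: y_coeff_def)
  qed
qed

section \<open>Members of N as block Toeplitz matrices\<close>

lemma N_set_iff:
  "X \<in> N_set (4 * k) \<longleftrightarrow> (\<exists>x. (\<forall>l\<in>{1..<k}. x l \<in> carrier_mat 2 2) \<and>
     toeplitz k (x_coeff x) (y_coeff x) X)"
proof -
  let ?R = "\<lambda>x p q. if p = q then 1\<^sub>m 2
                else if odd p \<and> odd q \<and> p < q then x ((q - p) div 2)
                else if even p \<and> even q \<and> p > q
                  then - transpose_mat (x ((p - q) div 2)) + star x ((p - q) div 2)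
                else 0\<^sub>m 2 2 :: complex mat"
  have eqv: "(X \<in> carrier_mat (4 * k) (4 * k) \<and> (\<forall>p\<in>{1..2 * k}. \<forall>q\<in>{1..2 * k}. block2 X p q = ?R x p q))
      \<longleftrightarrow> toeplitz k (x_coeff x) (y_coeff x) X"
    if x: "\<forall>l\<in>{1..<k}. x l \<in> carrier_mat 2 2" for x
  proof -
    \<comment> \<open>Comparing blocks entry by entry needs 2 by 2 matrices on both sides. Positions
      of equal parity up to 2k give indices in \<open>{1..<k}\<close>, where x is
      constrained.\<close>
    have R_carrier: "?R x p q \<in> carrier_mat 2 2" if "p \<in> {1..2 * k}" "q \<in> {1..2 * k}" for p q
    proof -
      have "(q - p) div 2 \<in> {1..<k}" if "odd p" "odd q" "p < q"
        using that \<open>q \<in> _\<close> by (auto elim!: oddE)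
      moreover have "(p - q) div 2 \<in> {1..<k}" if "even p" "even q" "q < p"
        using that \<open>p \<in> _\<close> \<open>q \<in> _\<close> by (auto elim!: evenE)
      ultimately show ?thesis using x by auto
    qed
    have block_eq: "block2 X p q = ?R x p q \<longleftrightarrow>
        (\<forall>a<2. \<forall>b<2. X $$ (2 * (p - 1) + a, 2 * (q - 1) + b) = ?R x p q $$ (a, b))"
      if "p \<in> {1..2 * k}" "q \<in> {1..2 * k}" for p q
    proof -
      have "block2 X p q = C \<longleftrightarrow>
        (\<forall>a<2. \<forall>b<2. X $$ (2 * (p - 1) + a, 2 * (q - 1) + b) = C $$ (a, b))"
        if "C \<in> carrier_mat 2 2" for C
        using that by (auto simp: block2_def mat_eq_iff)
      from this[OF R_carrier[OF that]] show ?thesis .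
    qed
    have split: "(\<forall>p\<in>{1..2 * k}. P p) \<longleftrightarrow> (\<forall>s<k. P (2 * s + 1) \<and> P (2 * s + 2))" for P
    proof
      assume P: "\<forall>s<k. P (2 * s + 1) \<and> P (2 * s + 2)"
      show "\<forall>p\<in>{1..2 * k}. P p"
      proof
        fix p assume p: "p \<in> {1..2 * k}"
        show "P p"
        proof (cases "even p")
          case True
          then obtain r where "p = 2 * r" by (elim evenE)
          then show ?thesis using P[rule_format, of "r - 1"] p by (cases r) auto
        next
          case False
          then obtain r where "p = 2 * r + 1" by (elim oddE)
          then show ?thesis using P[rule_format, of r] p by auto
        qed
      qed
    qed auto
    have x_dim: "dim_row (x l) = 2" "dim_col (x l) = 2" if "l \<in> {1..<k}" for l
      using x that by auto
    have entries: "(\<forall>p\<in>{1..2 * k}. \<forall>q\<in>{1..2 * k}. block2 X p q = ?R x p q) \<longleftrightarrow>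
       (\<forall>p\<in>{1..2 * k}. \<forall>q\<in>{1..2 * k}. \<forall>a<2. \<forall>b<2.
          X $$ (2 * (p - 1) + a, 2 * (q - 1) + b) = ?R x p q $$ (a, b))"
      using block_eq by blast
    have oo: "?R x (2 * s + 1) (2 * t + 1) $$ (a, b) = (if s \<le> t then x_coeff x (t - s) a b else 0)"
      if "s < k" "t < k" "a < 2" "b < 2" for s t a b
      using that by (auto simp: x_coeff_def kronecker_def diff_mult_distrib2[symmetric])
    have ee: "?R x (2 * s + 2) (2 * t + 2) $$ (a, b) = (if t \<le> s then y_coeff x (s - t) a b else 0)"
      if "s < k" "t < k" "a < 2" "b < 2" for s t a b
    proof (cases "t < s")
      case True
      then have "s - t \<in> {1..<k}" using that by auto
      then show ?thesis
        using True that x_dim[of "s - t"]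
        by (auto simp: y_coeff_def diff_mult_distrib2[symmetric])
    next
      case False
      then show ?thesis using that by (auto simp: y_coeff_def kronecker_def)
    qed
    have oe: "?R x (2 * s + 1) (2 * t + 2) $$ (a, b) = 0"
      if "a < 2" "b < 2" for s t a b
    proof -
      have "2 * s + 1 \<noteq> 2 * t + 2" by presburger
      then show ?thesis using that by simp
    qed
    have eo: "?R x (2 * s + 2) (2 * t + 1) $$ (a, b) = 0"
      if "a < 2" "b < 2" for s t a b
    proof -
      have "2 * s + 2 \<noteq> 2 * t + 1" by presburger
      then show ?thesis using that by simp
    qed
    have pos: "2 * (2 * s + 1 - 1) + a = 4 * s + a" "2 * (2 * s + 2 - 1) + a = 4 * s + 2 + a" for s a :: nat
      by simp_all
    have split2: "(\<forall>p\<in>{1..2 * k}. \<forall>q\<in>{1..2 * k}. P p q) \<longleftrightarrow>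
        (\<forall>s<k. \<forall>t<k. P (2 * s + 1) (2 * t + 1) \<and> P (2 * s + 2) (2 * t + 2) \<and>
          P (2 * s + 1) (2 * t + 2) \<and> P (2 * s + 2) (2 * t + 1))" for P
      unfolding split by blast
    have distrib: "(\<forall>a<2::nat. \<forall>b<2::nat. E1 a b \<and> E2 a b \<and> E3 a b \<and> E4 a b) \<longleftrightarrow>
        (\<forall>a<2. \<forall>b<2. E1 a b) \<and> (\<forall>a<2. \<forall>b<2. E2 a b) \<and>
        (\<forall>a<2. \<forall>b<2. E3 a b) \<and> (\<forall>a<2. \<forall>b<2. E4 a b)" for E1 E2 E3 E4
      by blast
    have "(\<forall>p\<in>{1..2 * k}. \<forall>q\<in>{1..2 * k}. block2 X p q = ?R x p q) \<longleftrightarrow>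
      (\<forall>s<k. \<forall>t<k.
        (\<forall>a<2. \<forall>b<2. X $$ (4 * s + a, 4 * t + b) = ?R x (2 * s + 1) (2 * t + 1) $$ (a, b)) \<and>
        (\<forall>a<2. \<forall>b<2. X $$ (4 * s + 2 + a, 4 * t + 2 + b) = ?R x (2 * s + 2) (2 * t + 2) $$ (a, b)) \<and>
        (\<forall>a<2. \<forall>b<2. X $$ (4 * s + a, 4 * t + 2 + b) = ?R x (2 * s + 1) (2 * t + 2) $$ (a, b)) \<and>
        (\<forall>a<2. \<forall>b<2. X $$ (4 * s + 2 + a, 4 * t + b) = ?R x (2 * s + 2) (2 * t + 1) $$ (a, b)))"
      unfolding entries split2 pos by (rule refl)
    also have "\<dots> \<longleftrightarrow> (\<forall>s<k. \<forall>t<k.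
        (\<forall>a<2. \<forall>b<2. X $$ (4 * s + a, 4 * t + b) = (if s \<le> t then x_coeff x (t - s) a b else 0)) \<and>
        (\<forall>a<2. \<forall>b<2. X $$ (4 * s + 2 + a, 4 * t + 2 + b) = (if t \<le> s then y_coeff x (s - t) a b else 0)) \<and>
        (\<forall>a<2. \<forall>b<2. X $$ (4 * s + a, 4 * t + 2 + b) = 0) \<and>
        (\<forall>a<2. \<forall>b<2. X $$ (4 * s + 2 + a, 4 * t + b) = 0))"
      by (intro all_cong1 imp_cong conj_cong refl) (simp_all only: oo ee oe eo)
    finally show ?thesis unfolding toeplitz_def distrib by (rule arg_cong)
  qed
  have m: "4 * k div 2 = 2 * k" "{1..(2 * k - 2) div 2} = {1..<k}" by auto
  show ?thesis
    unfolding N_set_def Let_def m mem_Collect_eq using eqv by blast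
qed

section \<open>The leading block and normality\<close>

definition leading_block :: "complex mat \<Rightarrow> complex mat" where
  "leading_block X = mat 2 2 (\<lambda>(a, b). X $$ (a, b))"

text \<open>A solution with u(0) = 1 determines x as the coefficients of u. Its lower symbol v and
  \<open>y_coeff x\<close> are then both inverse to u^t modulo z^k, so they agree by
  cancellation.\<close>

lemma N_set_eq:
  assumes k: "k \<ge> 1"
  shows "N_set (4 * k) = {X \<in> Sol (4 * k) (shift2 (4 * k)). leading_block X = 1\<^sub>m 2}"
proof (intro equalityI subsetI CollectI)
  have lead: "leading_block X = 1\<^sub>m 2 \<longleftrightarrow> (\<forall>a<2. \<forall>b<2. u 0 a b = kronecker a b)"
    if "toeplitz k u v X" for u v X
    using toeplitzD(2)[OF that, of 0 0] k by (auto simp: leading_block_def mat_eq_iff kronecker_def)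
  {
    fix X assume "X \<in> N_set (4 * k)"
    then obtain x where x: "\<forall>l\<in>{1..<k}. x l \<in> carrier_mat 2 2"
      and T: "toeplitz k (x_coeff x) (y_coeff x) X"
      unfolding N_set_iff by blast
    then show "X \<in> Sol (4 * k) (shift2 (4 * k)) \<and> leading_block X = 1\<^sub>m 2"
      unfolding toeplitz_Sol_iff[OF T] lead[OF T]
      using conv_x_y_coeff[of k x] by (auto simp: x_coeff_def)
  }
  fix X assume "X \<in> {X \<in> Sol (4 * k) (shift2 (4 * k)). leading_block X = 1\<^sub>m 2}"
  then have X: "X \<in> Sol (4 * k) (shift2 (4 * k))" and L: "leading_block X = 1\<^sub>m 2" by auto
  from Sol_toeplitz[OF X k] obtain u v where T: "toeplitz k u v X" by blast
  have u: "u 0 a b = kronecker a b" if "a < 2" "b < 2" for a b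
    using lead[OF T] L that by simp
  define x where "x l = mat 2 2 (\<lambda>(a, b). u l a b)" for l
  have x: "x l \<in> carrier_mat 2 2" for l by (simp add: x_def)
  have xu: "x_coeff x l a b = u l a b" if "a < 2" "b < 2" for l a b
    using that u by (simp add: x_coeff_def x_def)
  have cv: "conv (x_coeff x) v l a b = conv (x_coeff x) (y_coeff x) l a b"
    if "l < k" "a < 2" "b < 2" for l a b
  proof -
    have "conv (x_coeff x) v l a b = conv u v l a b"
      using that by (simp add: conv_def xu)
    also have "\<dots> = (if l = 0 then kronecker a b else 0)"
      using X that unfolding toeplitz_Sol_iff[OF T] by blast
    also have "\<dots> = conv (x_coeff x) (y_coeff x) l a b"
      using conv_x_y_coeff[OF x that] by simp
    finally show ?thesis .
  qed
  have vy: "v l a b = y_coeff x l a b" if "l < k" "a < 2" "b < 2" for l a b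
    by (rule conv_left_cancel[OF _ cv that]) (auto simp: x_coeff_def)
  have "toeplitz k (x_coeff x) (y_coeff x) X"
    using T xu vy unfolding toeplitz_def by (simp add: less_imp_diff_less)
  then show "X \<in> N_set (4 * k)" unfolding N_set_iff using x by blast
qed

text \<open>By the Toeplitz form the first two columns of Y vanish below row 1, so only the leading
  blocks meet in the leading block of the product.\<close>

lemma leading_block_mult:
  assumes X: "X \<in> Sol (4 * k) (shift2 (4 * k))" and Y: "Y \<in> Sol (4 * k) (shift2 (4 * k))"
    and k: "k \<ge> 1"
  shows "leading_block (X * Y) = leading_block X * leading_block Y"
proof (rule eq_matI)
  fix a b assume "a < dim_row (leading_block X * leading_block Y)"
    "b < dim_col (leading_block X * leading_block Y)"
  then have ab: "a < 2" "b < 2" by (auto simp: leading_block_def)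
  note XC = SolD(1)[OF X] and YC = SolD(1)[OF Y] and D = toeplitzD[OF Sol_toeplitz[OF Y k]]
  have zero: "Y $$ (j, b) = 0" if j: "j < 4 * k" "2 \<le> j" for j
    using j(1)
  proof (cases rule: nat_4_cases)
    case (0 s c)
    then show ?thesis using D(2)[of s 0 c b] j k ab by auto
  next
    case (2 s c)
    then show ?thesis using D(5)[of s 0 c b] k ab by auto
  qed
  have "(X * Y) $$ (a, b) = (\<Sum>j<4 * k. X $$ (a, j) * Y $$ (j, b))"
    using XC YC ab k by (simp add: scalar_prod_def lessThan_atLeast0)
  also have "\<dots> = (\<Sum>j<2. X $$ (a, j) * Y $$ (j, b))"
    using k zero by (intro sum.mono_neutral_right) auto
  finally show "leading_block (X * Y) $$ (a, b) = (leading_block X * leading_block Y) $$ (a, b)"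
    using ab by (simp add: leading_block_def scalar_prod_def lessThan_atLeast0)
qed (auto simp: leading_block_def)

theorem proposition5p17:
  fixes n :: nat
  assumes "n mod 4 = 0" and "n \<ge> 4"
  shows "N_set n \<lhd> Sol_monoid n (shift_mat n ^\<^sub>m 2)"
proof -
  obtain k where n: "n = 4 * k" using assms(1) by auto
  have k: "k \<ge> 1" using assms(2) n by simp
  let ?G = "Sol_monoid n (shift2 n)"
  let ?R = "ring_mat TYPE(complex) 2 ()"
  interpret G: group ?G by (rule Sol_group[OF assms(2)])
  interpret R: ring ?R by (rule ring_mat)
  have carrier: "carrier ?G = Sol (4 * k) (shift2 (4 * k))" by (simp add: Sol_monoid_def n)
  have mult: "leading_block (X \<otimes>\<^bsub>?G\<^esub> Y) = leading_block X \<otimes>\<^bsub>?R\<^esub> leading_block Y"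
    if "X \<in> carrier ?G" "Y \<in> carrier ?G" for X Y
    using leading_block_mult[of X k Y] that k unfolding carrier
    by (simp add: Sol_monoid_def ring_mat_def)
  have one: "leading_block \<one>\<^bsub>?G\<^esub> = \<one>\<^bsub>?R\<^esub>"
    using assms(2) by (auto simp: leading_block_def Sol_monoid_def ring_mat_def)
  \<comment> \<open>The group inverse of X maps to a two-sided inverse, so the leading block takes
    values in GL_2(C), the unit group of \<open>?R\<close>.\<close>
  have unit: "leading_block X \<in> Units ?R" if X: "X \<in> carrier ?G" for X
  proof -
    have "leading_block Y \<in> carrier ?R" for Y by (simp add: leading_block_def ring_mat_def)
    moreover have "leading_block (inv\<^bsub>?G\<^esub> X) \<otimes>\<^bsub>?R\<^esub> leading_block X = \<one>\<^bsub>?R\<^esub>"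
      "leading_block X \<otimes>\<^bsub>?R\<^esub> leading_block (inv\<^bsub>?G\<^esub> X) = \<one>\<^bsub>?R\<^esub>"
      using X one by (simp_all flip: mult)
    ultimately show ?thesis unfolding Units_def by blast
  qed
  have "leading_block \<in> hom ?G (units_of ?R)"
    using unit mult by (auto simp: hom_def units_of_def)
  then interpret group_hom ?G "units_of ?R" leading_block
    by (intro group_hom.intro group_hom_axioms.intro G.is_group R.units_group)
  have "N_set n = kernel ?G (units_of ?R) leading_block"
    using N_set_eq[OF k] unfolding kernel_def carrier unfolding n
    by (simp add: units_of_def ring_mat_def)
  then show ?thesis using normal_kernel by (simp add: shift2_def)
qed

end
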